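(* Let $\alpha>0$ and let $D$ be an Eulerian multi-digraph on $n$ vertices whose underlying simple graph, obtained from $D$ by ignoring directions and multiplicities, has minimum degree at least $\alpha n$. Then $D$ immerses $\overrightarrow{K}_s$, where $s = 10^{-9}\alpha^4 n$ (rounded down to an integer).
   Context: Multi-digraphs have no loops but may contain several copies of an edge; degrees are counted with multiplicity. A multi-digraph is Eulerian if at every vertex the in-degree equals the out-degree. $\overrightarrow{K}_s$ is the complete digraph on $s$ vertices, with edges in both directions between every two vertices. A multi-digraph $G$ immerses $H$ if there is an injective $f:V(H)\to V(G)$ and pairwise edge-disjoint directed paths $P_e$ in $G$, one per edge $e=uv$ of $H$, from $f(u)$ to $f(v)$. *)

theory Defs
  imports Complex_Main "HOL-Library.Disjoint_Sets" "Graph_Theory.Graph_Theory"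
begin

text \<open>
  Parallel arcs are distinct elements of the set of arcs, so \<^const>\<open>in_degree\<close> and
  \<^const>\<open>out_degree\<close> count with multiplicity.
\<close>
locale multi_digraph = fin_digraph + loopfree_digraph

definition eulerian :: "('a, 'b) pre_digraph \<Rightarrow> bool" where
  "eulerian G \<longleftrightarrow> (\<forall>v \<in> verts G. in_degree G v = out_degree G v)"

text \<open>
  The underlying simple graph is \<^term>\<open>mk_symmetric G\<close>, in which each undirected edge
  \<open>uv\<close> is the pair of arcs \<open>(u, v)\<close>, \<open>(v, u)\<close>; the undirected degree of a vertex is therefore
  its out-degree there (and not the sum of its in-degree and its out-degree).
\<close>
definition underlying_degree :: "('a, 'b) pre_digraph \<Rightarrow> 'a \<Rightarrow> nat" where
  "underlying_degree G v = out_degree (with_proj (mk_symmetric G)) v"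

lemma (in loopfree_digraph) underlying_degree_eq_card_neighbours:
  "underlying_degree G v = card {u \<in> verts G - {v}. v \<rightarrow>\<^bsub>G\<^esub> u \<or> u \<rightarrow>\<^bsub>G\<^esub> v}"
proof -
  have "out_arcs (with_proj (mk_symmetric G)) v
      = Pair v ` {u \<in> verts G - {v}. v \<rightarrow>\<^bsub>G\<^esub> u \<or> u \<rightarrow>\<^bsub>G\<^esub> v}"
    using no_loops by (fastforce simp: parcs_mk_symmetric arcs_ends_conv)
  then show ?thesis
    by (simp add: underlying_degree_def out_degree_def card_image inj_on_def)
qed

definition immerses :: "('a, 'b) pre_digraph \<Rightarrow> ('c, 'd) pre_digraph \<Rightarrow> bool" where
  "immerses G H \<longleftrightarrow> (\<exists>f P. inj_on f (verts H) \<and> f ` verts H \<subseteq> verts G \<and>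
     (\<forall>e \<in> arcs H. pre_digraph.apath G (f (tail H e)) (P e) (f (head H e))) \<and>
     disjoint_family_on (\<lambda>e. set (P e)) (arcs H))"

text \<open>
  \<^const>\<open>complete_digraph\<close> is a property of a digraph, satisfied for every order:
\<close>
lemma complete_digraph_exists:
  "complete_digraph s
     (with_proj \<lparr>pverts = {..<s}, parcs = {(u, v). u < s \<and> v < s \<and> u \<noteq> v}\<rparr>)"
  by (auto simp: complete_digraph_pair_def)

end

theory Submission
  imports Defs
begin

text \<open>
  Keep one arc for every edge of the underlying simple graph and let \<open>e(Y)\<close> be the number of kept
  arcs inside \<open>Y\<close>. If \<open>X\<close> maximises \<open>e(Y) / |Y| powr (3/2)\<close>, then every bipartition \<open>X = S \<union> T\<close> is crossed by
  at least \<open>c |S| |T|\<close> kept arcs, where \<open>c = e(X) / |X|\<^sup>2\<close>, and \<open>c\<^sup>4 |X| \<ge> \<alpha>\<^sup>4 n / 16\<close>. (The exponent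
  \<open>3/2\<close> is what saves a factor \<open>\<alpha>\<close> when \<open>X\<close> is much smaller than the vertex set.)

  Let \<open>F\<close> be the kept arcs inside \<open>X\<close>. The remaining arcs of \<open>D\<close> split into closed walks and walks
  between vertices of \<open>X\<close>; contracting the latter to single arcs gives, together with \<open>F\<close>, an Eulerian
  multi-digraph on \<open>X\<close> in which no contracted arc ends where another one starts. Hence the degree of
  a vertex is its in- or its out-degree in the simple digraph \<open>F\<close>, so it lies between about
  \<open>c |X| / 2\<close> and \<open>|X|\<close>. Moreover the head of a contracted arc has only out-arcs from \<open>F\<close>, so two
  steps always reach linearly many vertices. By the Eulerian property every cut has at least
  \<open>c |S| |T| / 2\<close> arcs in each direction, and breadth-first search joins any two vertices within
  \<open>O(c\<^sup>-\<^sup>2)\<close> steps.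

  All this survives the deletion of few arcs and vertices, so pairs among \<open>2s\<close> terminals can be
  joined greedily by short arc-disjoint walks. A maximal such family misses only pairs containing one
  of at most \<open>s\<close> terminals, namely those that are overloaded or send or receive many arcs to or from
  overloaded vertices.
\<close>

section \<open>Eulerian digraphs with large cuts\<close>

lemma (in fin_digraph) card_tail_in:
  assumes "S \<subseteq> verts G"
  shows "card {e \<in> arcs G. tail G e \<in> S} = (\<Sum>v\<in>S. out_degree G v)"
proof -
  have fS: "finite S" by (rule finite_subset[OF assms finite_verts])
  have "{e \<in> arcs G. tail G e \<in> S} = (\<Union>v\<in>S. out_arcs G v)" by auto
  then show ?thesis unfolding out_degree_def
    by (simp only:, intro card_UN_disjoint) (auto simp: fS)
qed

lemma (in fin_digraph) card_head_in:
  assumes "S \<subseteq> verts G"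
  shows "card {e \<in> arcs G. head G e \<in> S} = (\<Sum>v\<in>S. in_degree G v)"
proof -
  have fS: "finite S" by (rule finite_subset[OF assms finite_verts])
  have "{e \<in> arcs G. head G e \<in> S} = (\<Union>v\<in>S. in_arcs G v)" by auto
  then show ?thesis unfolding in_degree_def
    by (simp only:, intro card_UN_disjoint) (auto simp: fS)
qed

text \<open>Summed over \<open>S\<close>, out-degrees and in-degrees agree, and the arcs inside
  \<open>S\<close> contribute equally to both sums.\<close>

lemma (in fin_digraph) eulerian_cut:
  assumes "eulerian G" "S \<subseteq> verts G"
  shows "card {e \<in> arcs G. tail G e \<in> S \<and> head G e \<notin> S}
       = card {e \<in> arcs G. tail G e \<notin> S \<and> head G e \<in> S}"
proof -
  let ?I = "{e \<in> arcs G. tail G e \<in> S \<and> head G e \<in> S}"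
  have "card {e \<in> arcs G. tail G e \<in> S} = card {e \<in> arcs G. head G e \<in> S}"
    unfolding card_tail_in[OF assms(2)] card_head_in[OF assms(2)]
    using assms by (intro sum.cong) (auto simp: eulerian_def)
  moreover have "card {e \<in> arcs G. tail G e \<in> S}
      = card ?I + card {e \<in> arcs G. tail G e \<in> S \<and> head G e \<notin> S}"
    by (subst card_Un_disjoint[symmetric]) (auto intro: arg_cong[of _ _ card])
  moreover have "card {e \<in> arcs G. head G e \<in> S}
      = card ?I + card {e \<in> arcs G. tail G e \<notin> S \<and> head G e \<in> S}"
    by (subst card_Un_disjoint[symmetric]) (auto intro: arg_cong[of _ _ card])
  ultimately show ?thesis by simp
qed

text \<open>Reversal keeps the arc set, so each bound for out-arcs and forward reach also yields the
  one for in-arcs and backward reach, with the same \<open>F\<close>, \<open>U\<close> and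
  \<open>Z\<close>.\<close>

definition rev_digraph :: "('a, 'b) pre_digraph \<Rightarrow> ('a, 'b) pre_digraph" where
  "rev_digraph G = G\<lparr>tail := head G, head := tail G\<rparr>"

lemma rev_digraph_simps [simp]:
  "verts (rev_digraph G) = verts G" "arcs (rev_digraph G) = arcs G"
  "tail (rev_digraph G) = head G" "head (rev_digraph G) = tail G"
  "out_arcs (rev_digraph G) = in_arcs G" "in_arcs (rev_digraph G) = out_arcs G"
  "out_degree (rev_digraph G) = in_degree G" "in_degree (rev_digraph G) = out_degree G"
  by (auto simp: rev_digraph_def in_arcs_def out_arcs_def in_degree_def out_degree_def fun_eq_iff)

text \<open>\<open>arcs G - F\<close> holds the contracted arcs, which may be parallel.
  \<open>F_simple\<close> rules out antiparallel as well as parallel arcs in \<open>F\<close>, and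
  \<open>no_through\<close> with \<open>p = q\<close> rules out contracted loops.\<close>

locale expanding_eulerian = fin_digraph G for G :: "('a, 'b) pre_digraph" (structure) +
  fixes F :: "'b set" and c :: real
  assumes eulerian: "eulerian G"
    and F_arcs: "F \<subseteq> arcs G"
    and F_simple: "inj_on (\<lambda>e. {tail G e, head G e}) F"
    and F_loopfree: "e \<in> F \<Longrightarrow> tail G e \<noteq> head G e"
    and no_through: "p \<in> arcs G - F \<Longrightarrow> q \<in> arcs G - F \<Longrightarrow> head G p \<noteq> tail G q"
    and c_pos: "0 < c"
    and expansion: "S \<subseteq> verts G \<Longrightarrow>
      c * card S * card (verts G - S) \<le> card {e \<in> F. (tail G e \<in> S) \<noteq> (head G e \<in> S)}"
    and large: "card (verts G) \<ge> 5"

lemma expanding_eulerian_rev: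
  assumes "expanding_eulerian G F c"
  shows "expanding_eulerian (rev_digraph G) F c"
proof -
  interpret expanding_eulerian G F c by fact
  show ?thesis
    using eulerian F_arcs F_simple F_loopfree no_through c_pos expansion large
    by unfold_locales (auto simp: eulerian_def insert_commute eq_commute)
qed

section \<open>Degrees and directed cuts\<close>

context expanding_eulerian
begin

abbreviation m :: real where "m \<equiv> real (card (verts G))"

lemma m_ge: "m \<ge> 5" using large by simp

lemma inj_head_F: "inj_on (head G) (F \<inter> out_arcs G v)"
  using F_simple by (auto simp: inj_on_def)

lemma out_F_le: "card (F \<inter> out_arcs G v) \<le> card (verts G)"
  by (rule card_inj_on_le[OF inj_head_F]) (use F_arcs in auto)

lemma inj_tail_F: "inj_on (tail G) (F \<inter> in_arcs G v)"
  using F_simple by (auto simp: inj_on_def)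

lemma in_F_le: "card (F \<inter> in_arcs G v) \<le> card (verts G)"
  by (rule card_inj_on_le[OF inj_tail_F]) (use F_arcs in auto)

lemma degree_eq: "v \<in> verts G \<Longrightarrow> in_degree G v = out_degree G v"
  using eulerian by (auto simp: eulerian_def)

text \<open>Contracted arcs cannot both enter and leave \<open>v\<close>, so all out-arcs or all
  in-arcs of \<open>v\<close> lie in \<open>F\<close>. That side has at most one arc per vertex, and
  the other side has the same size.\<close>

lemma out_degree_le: 
  assumes "v \<in> verts G"
  shows "out_degree G v \<le> card (verts G)"
proof (cases "out_arcs G v \<subseteq> F")
  case True
  then show ?thesis using out_F_le[of v] by (simp add: out_degree_def Int_absorb1)
next
  case False
  then have "in_arcs G v \<subseteq> F" using no_through by fastforce
  then show ?thesis using in_F_le[of v] degree_eq[OF assms] by (simp add: in_degree_def Int_absorb1)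
qed

lemma in_degree_le: "v \<in> verts G \<Longrightarrow> in_degree G v \<le> card (verts G)"
  using out_degree_le degree_eq by simp

text \<open>Expansion of \<open>{v}\<close> gives \<open>c * (m - 1)\<close> arcs of
  \<open>F\<close> at \<open>v\<close>, hence half as many out-arcs; \<open>5 \<le> m\<close> makes
  \<open>m - 1\<close> at least \<open>4/5 * m\<close>.\<close>

lemma out_degree_ge:
  assumes "v \<in> verts G"
  shows "2 * c / 5 * m \<le> out_degree G v"
proof -
  have "c * 1 * card (verts G - {v}) \<le> card {e \<in> F. (tail G e \<in> {v}) \<noteq> (head G e \<in> {v})}"
    using expansion[of "{v}"] assms by simp
  also have "card {e \<in> F. (tail G e \<in> {v}) \<noteq> (head G e \<in> {v})} \<le> card (out_arcs G v \<union> in_arcs G v)"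
    using F_arcs by (intro card_mono) auto
  also have "\<dots> \<le> out_degree G v + in_degree G v"
    unfolding in_degree_def out_degree_def by (rule card_Un_le)
  finally have "c * card (verts G - {v}) \<le> 2 * real (out_degree G v)"
    using degree_eq[OF assms] by simp
  moreover have "real (card (verts G - {v})) = m - 1"
    using assms large by (simp add: card_Diff_singleton of_nat_diff)
  moreover have "c * (4/5 * m) \<le> c * (m - 1)"
    using c_pos m_ge by (intro mult_left_mono) auto
  ultimately show ?thesis by simp
qed

lemma out_arcs_head: "e \<in> arcs G - F \<Longrightarrow> out_arcs G (head G e) \<subseteq> F"
  using no_through by fastforce

text \<open>\<open>expansion\<close> counts crossing arcs of both directions; by
  \<open>eulerian_cut\<close> both directions are equally frequent in \<open>G\<close>.\<close>

lemma cut_ge: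
  assumes "S \<subseteq> verts G"
  shows "c / 2 * card S * card (verts G - S) \<le> card {e \<in> arcs G. tail G e \<in> S \<and> head G e \<notin> S}"
proof -
  have "c * card S * card (verts G - S) \<le> card {e \<in> F. (tail G e \<in> S) \<noteq> (head G e \<in> S)}"
    by (rule expansion[OF assms])
  also have "card {e \<in> F. (tail G e \<in> S) \<noteq> (head G e \<in> S)} \<le>
    card ({e \<in> arcs G. tail G e \<in> S \<and> head G e \<notin> S} \<union> {e \<in> arcs G. tail G e \<notin> S \<and> head G e \<in> S})"
    using F_arcs by (intro card_mono) auto
  also have "\<dots> \<le> card {e \<in> arcs G. tail G e \<in> S \<and> head G e \<notin> S} + 
     card {e \<in> arcs G. tail G e \<notin> S \<and> head G e \<in> S}"
    by (rule card_Un_le)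
  finally show ?thesis using eulerian_cut[OF eulerian assms] by simp
qed

end

section \<open>Short walks avoiding few arcs and vertices\<close>

primrec reach :: "('a, 'b) pre_digraph \<Rightarrow> 'b set \<Rightarrow> 'a \<Rightarrow> nat \<Rightarrow> 'a set" where
  "reach G R t 0 = {t}"
| "reach G R t (Suc i) = reach G R t i \<union> head G ` {e \<in> R. tail G e \<in> reach G R t i}"

context wf_digraph
begin

lemma reach_subset_verts:
  assumes "t \<in> verts G" "R \<subseteq> arcs G"
  shows "reach G R t i \<subseteq> verts G"
  using assms by (induction i) auto

lemma reach_walk:
  assumes "t \<in> verts G" "R \<subseteq> arcs G" "v \<in> reach G R t i"
  shows "\<exists>p. awalk t p v \<and> set p \<subseteq> R \<and> length p \<le> i"
  using assms(3)
proof (induction i arbitrary: v)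
  case 0
  then show ?case using assms by (auto intro!: exI[of _ "[]"] simp: awalk_Nil_iff)
next
  case (Suc i)
  show ?case
  proof (cases "v \<in> reach G R t i")
    case True
    then show ?thesis using Suc.IH[of v] le_Suc_eq by auto
  next
    case False
    then obtain e where e: "e \<in> R" "tail G e \<in> reach G R t i" "head G e = v" using Suc.prems by auto
    then obtain p where p: "awalk t p (tail G e)" "set p \<subseteq> R" "length p \<le> i"
      using Suc.IH by blast
    have "awalk t (p @ [e]) v"
      using p(1) e assms(2) arc_implies_awalk by (intro awalk_appendI) (auto simp: awalk_def)
    then show ?thesis using p e by (intro exI[of _ "p @ [e]"]) auto
  qed
qed

lemma reach_rev_walk:
  assumes "t \<in> verts G" "R \<subseteq> arcs G" "v \<in> reach (rev_digraph G) R t i"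
  shows "\<exists>p. awalk v p t \<and> set p \<subseteq> R \<and> length p \<le> i"
  using assms(3)
proof (induction i arbitrary: v)
  case 0
  then show ?case using assms by (auto intro!: exI[of _ "[]"] simp: awalk_Nil_iff)
next
  case (Suc i)
  show ?case
  proof (cases "v \<in> reach (rev_digraph G) R t i")
    case True
    then show ?thesis using Suc.IH[of v] le_Suc_eq by auto
  next
    case False
    then obtain e where e: "e \<in> R" "head G e \<in> reach (rev_digraph G) R t i" "tail G e = v"
      using Suc.prems by auto
    then obtain p where p: "awalk (head G e) p t" "set p \<subseteq> R" "length p \<le> i"
      using Suc.IH by blast
    have "awalk v (e # p) t"
      using p(1) e assms(2) by (auto simp: awalk_Cons_iff)
    then show ?thesis using p e by (intro exI[of _ "e # p"]) auto
  qed
qed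

end

text \<open>In use, \<open>U\<close> is the set of arcs of the walks chosen so far and
  \<open>Z\<close> the set of vertices incident with too many of them.\<close>

definition residual :: "('a, 'b) pre_digraph \<Rightarrow> 'b set \<Rightarrow> 'a set \<Rightarrow> 'b set" where
  "residual G U Z = {e \<in> arcs G - U. tail G e \<notin> Z \<and> head G e \<notin> Z}"

lemma residual_rev [simp]: "residual (rev_digraph G) U Z = residual G U Z"
  by (auto simp: residual_def)

lemma residual_subset: "residual G U Z \<subseteq> arcs G"
  by (auto simp: residual_def)

section \<open>Growth of balls in the residual arcs\<close>

context expanding_eulerian
begin

lemma out_degree_le_residual:
  assumes "finite U" "v \<in> verts G - Z"
  shows "out_degree G v \<le> card (out_arcs G v \<inter> residual G U Z) + card {e \<in> U. tail G e = v}
    + card {e \<in> out_arcs G v. head G e \<in> Z}"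
proof -
  have "out_degree G v \<le> card (((out_arcs G v \<inter> residual G U Z) \<union> {e \<in> U. tail G e = v})
    \<union> {e \<in> out_arcs G v. head G e \<in> Z})"
    unfolding out_degree_def using assms by (intro card_mono) (auto simp: residual_def)
  also have "\<dots> \<le> card ((out_arcs G v \<inter> residual G U Z) \<union> {e \<in> U. tail G e = v})
    + card {e \<in> out_arcs G v. head G e \<in> Z}" by (rule card_Un_le)
  also have "\<dots> \<le> card (out_arcs G v \<inter> residual G U Z) + card {e \<in> U. tail G e = v}
    + card {e \<in> out_arcs G v. head G e \<in> Z}" by (intro add_right_mono card_Un_le)
  finally show ?thesis .
qed

text \<open>Many out-arcs give many out-neighbours only if they lie in \<open>F\<close>, since
  contracted arcs may be parallel. If a contracted arc at \<open>t\<close> survives, its head has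
  all its out-arcs in \<open>F\<close>, and the second step uses those.\<close>

lemma reach_2_ge:
  assumes U: "U \<subseteq> arcs G" and Z: "Z \<subseteq> verts G" and t: "t \<in> verts G - Z"
    and load: "\<And>v. v \<in> verts G - Z \<Longrightarrow> card {e \<in> U. tail G e = v} \<le> c * m / 16"
    and good: "card {e \<in> out_arcs G t. head G e \<in> Z} \<le> c * m / 8"
    and cZ: "card Z \<le> c * m / 8"
  shows "c * m / 8 \<le> card (reach G (residual G U Z) t 2)"
proof -
  let ?R = "residual G U Z" and ?B = "reach G (residual G U Z) t 2"
  have finU: "finite U" using U finite_arcs finite_subset by metis
  have finB: "finite ?B" using reach_subset_verts[of t ?R 2] t residual_subset[of G U Z]
    by (intro finite_subset[OF _ finite_verts]) auto
  have cm: "c * m > 0" using c_pos m_ge by simp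
  \<comment> \<open>Of at least \<open>2/5 * c * m\<close> out-arcs, at most
    \<open>c * m / 16\<close> are used and at most \<open>c * m / 8\<close> lead into
    \<open>Z\<close>.\<close>
  have *: "c * m / 8 \<le> card (out_arcs G v \<inter> ?R)"
    if "v \<in> verts G - Z" "card {e \<in> out_arcs G v. head G e \<in> Z} \<le> c * m / 8" for v
    using out_degree_le_residual[OF finU that(1)] out_degree_ge[of v] load[OF that(1)] that cm by simp
  have **: "c * m / 8 \<le> card ?B" if "v \<in> verts G - Z" "card {e \<in> out_arcs G v. head G e \<in> Z} \<le> c * m / 8"
     "v \<in> reach G ?R t 1" "out_arcs G v \<inter> ?R \<subseteq> F" for v
  proof -
    have "head G ` (out_arcs G v \<inter> ?R) \<subseteq> ?B" using that(3) by (auto simp: numeral_2_eq_2)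
    moreover have "inj_on (head G) (out_arcs G v \<inter> ?R)"
      by (rule inj_on_subset[OF inj_head_F[of v]]) (use that in auto)
    ultimately have "card (out_arcs G v \<inter> ?R) \<le> card ?B"
      using finB by (intro card_inj_on_le)
    then show ?thesis using *[OF that(1,2)] by simp
  qed
  show ?thesis
  proof (cases "out_arcs G t \<inter> ?R \<subseteq> F")
    case True
    then show ?thesis using ** t good by simp
  next
    case False
    then obtain e where e: "e \<in> out_arcs G t" "e \<in> ?R" "e \<notin> F" by blast
    let ?b = "head G e"
    have F: "out_arcs G ?b \<subseteq> F" using e by (intro out_arcs_head) auto
    \<comment> \<open>\<open>good\<close> concerns \<open>t\<close> only. At \<open>?b\<close> the
      arcs into \<open>Z\<close> lie in \<open>F\<close> and have distinct heads, so there are at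
      most \<open>card Z\<close> of them.\<close>
    have "inj_on (head G) {e \<in> out_arcs G ?b. head G e \<in> Z}"
      by (rule inj_on_subset[OF inj_head_F[of ?b]]) (use F in auto)
    then have "card {e \<in> out_arcs G ?b. head G e \<in> Z} \<le> card Z"
      using finite_subset[OF Z finite_verts] by (intro card_inj_on_le[of "head G"]) auto
    then show ?thesis using e F cZ by (intro **[of ?b]) (auto simp: residual_def)
  qed
qed

text \<open>The ball and its complement, which contains \<open>C\<close>, both have size at least
  \<open>c * m / 8\<close>, and one of them at least \<open>m / 2\<close>. So
  \<open>c\<^sup>2 * m\<^sup>2 / 32\<close> arcs leave the ball, at least half of them in
  \<open>R\<close>, and each new vertex absorbs at most \<open>m\<close> of these.\<close>

lemma reach_growth:
  assumes R: "R \<subseteq> arcs G" and t: "t \<in> verts G"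
    and B: "c * m / 8 \<le> card (reach G R t i)"
    and C: "C \<subseteq> verts G" "c * m / 8 \<le> card C" "reach G R t i \<inter> C = {}"
    and lost: "card (arcs G - R) \<le> c\<^sup>2 * m\<^sup>2 / 64"
  shows "card (reach G R t i) + c\<^sup>2 * m / 64 \<le> card (reach G R t (Suc i))"
proof -
  let ?B = "reach G R t i" and ?B' = "reach G R t (Suc i)"
  let ?D = "{e \<in> R. tail G e \<in> ?B \<and> head G e \<notin> ?B}"
  have sub: "?B \<subseteq> verts G" "?B' \<subseteq> verts G" by (rule reach_subset_verts[OF t R])+
  have fin: "finite ?B" "finite ?B'" using sub finite_subset[OF _ finite_verts] by auto
  have le: "?B \<subseteq> ?B'" by simp
  define x y where "x = real (card ?B)" and "y = real (card (verts G - ?B))"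
  have xy: "x + y = m" unfolding x_def y_def
    using sub(1) fin card_mono[OF finite_verts sub(1)] by (simp add: card_Diff_subset of_nat_diff)
  have "card C \<le> card (verts G - ?B)" using C by (intro card_mono) auto
  then have y: "c * m / 8 \<le> y" using C unfolding y_def by linarith
  have x: "c * m / 8 \<le> x" using B unfolding x_def .
  have cm: "c * m > 0" using c_pos m_ge by simp
  have "c * m / 8 * (m / 2) \<le> x * y"
  proof (cases "x \<ge> m / 2")
    case True
    have "m / 2 * (c * m / 8) \<le> x * y" using True y cm m_ge by (intro mult_mono) auto
    then show ?thesis by (simp add: mult.commute)
  next
    case False
    then show ?thesis using xy x cm m_ge by (intro mult_mono) auto
  qed
  then have "c / 2 * (c * m / 8 * (m / 2)) \<le> c / 2 * (x * y)"
    using c_pos by (intro mult_left_mono) auto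
  then have "c\<^sup>2 * m\<^sup>2 / 32 \<le> c / 2 * x * y" by (simp add: power2_eq_square algebra_simps)
  also have "\<dots> \<le> card {e \<in> arcs G. tail G e \<in> ?B \<and> head G e \<notin> ?B}"
    unfolding x_def y_def by (rule cut_ge[OF sub(1)])
  also have "card {e \<in> arcs G. tail G e \<in> ?B \<and> head G e \<notin> ?B} \<le> card (?D \<union> (arcs G - R))"
    using R finite_subset[OF R finite_arcs] by (intro card_mono) auto
  also have "\<dots> \<le> card ?D + card (arcs G - R)" by (rule card_Un_le)
  finally have D: "c\<^sup>2 * m\<^sup>2 / 64 \<le> card ?D" using lost by simp
  have "?D \<subseteq> (\<Union>v\<in>?B' - ?B. in_arcs G v)" using R by auto
  then have "card ?D \<le> card (\<Union>v\<in>?B' - ?B. in_arcs G v)"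
    using fin by (intro card_mono finite_UN_I) auto
  also have "\<dots> \<le> (\<Sum>v\<in>?B' - ?B. in_degree G v)"
    unfolding in_degree_def using fin by (intro card_UN_le) auto
  also have "\<dots> \<le> (\<Sum>v\<in>?B' - ?B. card (verts G))"
    using sub(2) by (intro sum_mono in_degree_le) auto
  finally have "card ?D \<le> card (?B' - ?B) * card (verts G)" by simp
  then have "real (card ?D) \<le> card (?B' - ?B) * m" by (simp flip: of_nat_mult)
  with D have "c\<^sup>2 * m / 64 * m \<le> card (?B' - ?B) * m" by (simp add: power2_eq_square)
  then have "c\<^sup>2 * m / 64 \<le> card (?B' - ?B)" using m_ge by simp
  moreover have "card ?B' = card ?B + card (?B' - ?B)"
    using card_Diff_subset[OF fin(1) le] card_mono[OF fin(2) le] by linarith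
  ultimately show ?thesis by simp
qed

text \<open>The ball around \<open>t\<close> grows linearly until it meets the backward ball of
  radius 2 around \<open>u\<close>.\<close>

lemma residual_walk:
  assumes R: "R \<subseteq> arcs G" and t: "t \<in> verts G" "u \<in> verts G"
    and B: "c * m / 8 \<le> card (reach G R t 2)"
    and C: "c * m / 8 \<le> card (reach (rev_digraph G) R u 2)"
    and lost: "card (arcs G - R) \<le> c\<^sup>2 * m\<^sup>2 / 64"
    and "c \<le> 1"
  shows "\<exists>p. awalk t p u \<and> set p \<subseteq> R \<and> length p \<le> 68 / c\<^sup>2"
proof -
  let ?C = "reach (rev_digraph G) R u 2"
  define k where "k = nat \<lceil>64 / c\<^sup>2\<rceil>"
  have k: "64 / c\<^sup>2 \<le> k" "k \<le> 64 / c\<^sup>2 + 1" unfolding k_def using c_pos by (auto simp: le_nat_iff)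
  have Csub: "?C \<subseteq> verts G"
  proof -
    interpret r: expanding_eulerian "rev_digraph G" F c
      by (rule expanding_eulerian_rev) unfold_locales
    show ?thesis using r.reach_subset_verts[of u R 2] t R by simp
  qed
  \<comment> \<open>Growing \<open>k\<close> times from radius 2 would give more than
    \<open>m\<close> vertices. The last growth starts at radius \<open>k + 1\<close>, so
    disjointness is needed only up to there.\<close>
  have "\<exists>i \<le> k + 1. reach G R t i \<inter> ?C \<noteq> {}"
  proof (rule ccontr)
    assume "\<not> ?thesis"
    then have dis: "reach G R t i \<inter> ?C = {}" if "i \<le> k + 1" for i using that by blast
    have grow: "c * m / 8 + real i * (c\<^sup>2 * m / 64) \<le> card (reach G R t (2 + i))" if "i \<le> k" for i
      using that
    proof (induction i)
      case 0
      then show ?case using B by simp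
    next
      case (Suc i)
      then have IH: "c * m / 8 + real i * (c\<^sup>2 * m / 64) \<le> card (reach G R t (2 + i))" by simp
      have "0 \<le> real i * (c\<^sup>2 * m / 64)" by simp
      then have "c * m / 8 \<le> card (reach G R t (2 + i))" using IH by linarith
      then have "card (reach G R t (2 + i)) + c\<^sup>2 * m / 64 \<le> card (reach G R t (Suc (2 + i)))"
        using dis[of "2 + i"] Suc.prems C Csub lost R t by (intro reach_growth) auto
      moreover have "real (Suc i) * (c\<^sup>2 * m / 64) = real i * (c\<^sup>2 * m / 64) + c\<^sup>2 * m / 64"
        by (simp add: algebra_simps)
      ultimately have "c * m / 8 + real (Suc i) * (c\<^sup>2 * m / 64) \<le> card (reach G R t (Suc (2 + i)))"
        using IH by linarith
      then show ?case by (simp only: add_Suc_right)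
    qed
    have "m = 64 / c\<^sup>2 * (c\<^sup>2 * m / 64)" using c_pos by simp
    also have "\<dots> \<le> k * (c\<^sup>2 * m / 64)" using k by (intro mult_right_mono) auto
    also have "\<dots> < c * m / 8 + k * (c\<^sup>2 * m / 64)" using c_pos m_ge by simp
    also have "\<dots> \<le> card (reach G R t (2 + k))" by (rule grow) simp
    also have "\<dots> \<le> m" by (intro of_nat_mono card_mono finite_verts reach_subset_verts[OF t(1) R])
    finally show False by simp
  qed
  then obtain i v where i: "i \<le> k + 1" "v \<in> reach G R t i" "v \<in> ?C" by auto
  obtain p where p: "awalk t p v" "set p \<subseteq> R" "length p \<le> i" using reach_walk[OF t(1) R i(2)] by auto
  obtain q where q: "awalk v q u" "set q \<subseteq> R" "length q \<le> 2" using reach_rev_walk[OF t(2) R i(3)] by auto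
  \<comment> \<open>The two parts have lengths at most \<open>k + 1\<close> and 2, and
    \<open>k\<close> exceeds \<open>64 / c\<^sup>2\<close> by at most 1.\<close>
  have "real (length (p @ q)) \<le> 64 / c\<^sup>2 + 4" using p q i k by simp
  also have "\<dots> \<le> 64 / c\<^sup>2 + 4 / c\<^sup>2"
    using power_le_one[of c 2] \<open>c \<le> 1\<close> c_pos
    by (simp only: add_le_cancel_left) (simp add: pos_le_divide_eq)
  finally show ?thesis using p q
    by (intro exI[of _ "p @ q"]) (auto simp: add_divide_distrib[symmetric])
qed

end

section \<open>Arc-disjoint walks between all pairs of terminals\<close>

text \<open>Markov's inequality for counting measure.\<close>

lemma card_above_times_le_sum:
  fixes f :: "'a \<Rightarrow> real" and a :: real
  assumes "finite A" "\<And>v. v \<in> A \<Longrightarrow> 0 \<le> f v"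
  shows "card {v \<in> A. a < f v} * a \<le> sum f A"
proof -
  have "card {v \<in> A. a < f v} * a = (\<Sum>v\<in>{v \<in> A. a < f v}. a)" by simp
  also have "\<dots> \<le> (\<Sum>v\<in>{v \<in> A. a < f v}. f v)" by (intro sum_mono) auto
  also have "\<dots> \<le> sum f A" using assms by (intro sum_mono2) auto
  finally show ?thesis .
qed

lemma sum_card_fibres:
  assumes "finite U" "finite V" "f ` U \<subseteq> V"
  shows "(\<Sum>v\<in>V. card {e \<in> U. f e = v}) = card U"
proof -
  have "U = (\<Union>v\<in>V. {e \<in> U. f e = v})" using assms by auto
  also have "card \<dots> = (\<Sum>v\<in>V. card {e \<in> U. f e = v})"
    using assms by (intro card_UN_disjoint) auto
  finally show ?thesis by simp
qed

section \<open>Averaging bounds and the maximal family of walks\<close>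

context expanding_eulerian
begin

text \<open>Each arc of \<open>U\<close> loads its tail and its head, so the loads sum to
  \<open>2 * card U\<close>, and Markov's inequality applies.\<close>

lemma card_overloaded:
  assumes "U \<subseteq> arcs G"
  shows "card {v \<in> verts G. c * m / 16 < card {e \<in> U. tail G e = v} + card {e \<in> U. head G e = v}} * (c * m)
    \<le> 32 * real (card U)"
proof -
  have finU: "finite U" using assms finite_arcs finite_subset by metis
  have tails: "tail G ` U \<subseteq> verts G" and heads: "head G ` U \<subseteq> verts G" using assms by auto
  have "card {v \<in> verts G. c * m / 16 < real (card {e \<in> U. tail G e = v} + card {e \<in> U. head G e = v})} * (c * m / 16)
    \<le> (\<Sum>v\<in>verts G. real (card {e \<in> U. tail G e = v} + card {e \<in> U. head G e = v}))"
    by (intro card_above_times_le_sum) auto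
  also have "\<dots> = 2 * card U"
    using sum_card_fibres[OF finU finite_verts tails] sum_card_fibres[OF finU finite_verts heads]
    by (simp add: sum.distrib flip: of_nat_sum)
  finally show ?thesis by simp
qed

text \<open>Double counting: in-degrees are at most \<open>m\<close>, so at most
  \<open>card Z * m\<close> arcs enter \<open>Z\<close>. The factor \<open>m\<close>
  cancels.\<close>

lemma card_many_arcs_into:
  assumes "Z \<subseteq> verts G"
  shows "card {t \<in> verts G. c * m / 8 < card {e \<in> out_arcs G t. head G e \<in> Z}} * c \<le> 8 * real (card Z)"
proof -
  have finZ: "finite Z" using assms finite_verts finite_subset by metis
  have "card {t \<in> verts G. c * m / 8 < card {e \<in> out_arcs G t. head G e \<in> Z}} * (c * m / 8)
    \<le> (\<Sum>t\<in>verts G. real (card {e \<in> out_arcs G t. head G e \<in> Z}))"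
    by (intro card_above_times_le_sum) auto
  also have "\<dots> = (\<Sum>t\<in>verts G. real (card {e \<in> {e \<in> arcs G. head G e \<in> Z}. tail G e = t}))"
    by (intro sum.cong arg_cong[of _ _ card] arg_cong[of _ _ real]) auto
  also have "\<dots> = card {e \<in> arcs G. head G e \<in> Z}"
    by (subst of_nat_sum[symmetric], subst sum_card_fibres) auto
  also have "\<dots> = (\<Sum>v\<in>Z. in_degree G v)" by (simp add: card_head_in[OF assms])
  also have "\<dots> \<le> (\<Sum>v\<in>Z. m)" unfolding of_nat_sum using assms in_degree_le by (intro sum_mono) auto
  finally have "card {t \<in> verts G. c * m / 8 < card {e \<in> out_arcs G t. head G e \<in> Z}} * c * m \<le> 8 * real (card Z) * m"
    by simp
  then show ?thesis using m_ge by (simp only: mult_le_cancel_right)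
qed

lemma card_lost:
  assumes "U \<subseteq> arcs G" "Z \<subseteq> verts G"
  shows "card (arcs G - residual G U Z) \<le> card U + 2 * card Z * card (verts G)"
proof -
  have finU: "finite U" using assms finite_arcs finite_subset by metis
  have 1: "card {e \<in> arcs G. tail G e \<in> Z} \<le> card Z * card (verts G)"
    unfolding card_tail_in[OF assms(2)] using assms(2) out_degree_le by (intro sum_bounded_above[THEN order_trans]) auto
  have 2: "card {e \<in> arcs G. head G e \<in> Z} \<le> card Z * card (verts G)"
    unfolding card_head_in[OF assms(2)] using assms(2) in_degree_le by (intro sum_bounded_above[THEN order_trans]) auto
  have "card (arcs G - residual G U Z) \<le> card (U \<union> ({e \<in> arcs G. tail G e \<in> Z} \<union> {e \<in> arcs G. head G e \<in> Z}))"
    using finU by (intro card_mono) (auto simp: residual_def)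
  also have "\<dots> \<le> card U + card ({e \<in> arcs G. tail G e \<in> Z} \<union> {e \<in> arcs G. head G e \<in> Z})" by (rule card_Un_le)
  also have "\<dots> \<le> card U + (card {e \<in> arcs G. tail G e \<in> Z} + card {e \<in> arcs G. head G e \<in> Z})"
    by (intro add_left_mono card_Un_le)
  finally show ?thesis using 1 2 by simp
qed

lemma complete_packing:
  assumes "c \<le> 1" and s: "real s \<le> c ^ 4 * m / 10 ^ 6"
  shows "\<exists>T P. T \<subseteq> verts G \<and> card T = s \<and> (\<forall>x\<in>T. \<forall>y\<in>T. x \<noteq> y \<longrightarrow> awalk x (P (x, y)) y) \<and>
    disjoint_family_on (\<lambda>e. set (P e)) {(x, y) \<in> T \<times> T. x \<noteq> y}"
proof -
  have cm: "c * m > 0" using c_pos m_ge by simp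
  have c4: "c ^ 4 \<le> 1" "c ^ 5 \<le> c ^ 2"
    using c_pos \<open>c \<le> 1\<close> by (auto simp: power_le_one intro: power_decreasing)
  have "c ^ 4 * m \<le> 1 * m" using c4(1) by (intro mult_right_mono) auto
  then have sm: "1000000 * real s \<le> m" using s by simp
  \<comment> \<open>Twice as many candidates as needed, since up to \<open>s\<close> of them will be
    discarded.\<close>
  then have "2 * s \<le> card (verts G)" by simp
  then obtain T0 where T0: "T0 \<subseteq> verts G" "card T0 = 2 * s"
    by (meson obtain_subset_with_card_n)
  have finT0: "finite T0" using T0 finite_verts finite_subset by metis
  let ?pairs = "\<lambda>T. {(x, y) \<in> T \<times> T. x \<noteq> y}"
  define valid where "valid = (\<lambda>(Q, P). Q \<subseteq> ?pairs T0 \<and>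
    (\<forall>(x, y) \<in> Q. awalk x (P (x, y)) y \<and> length (P (x, y)) \<le> 68 / c\<^sup>2) \<and>
    disjoint_family_on (\<lambda>e. set (P e)) Q)"
  have "\<exists>QP. valid QP \<and> (\<forall>QP'. valid QP' \<longrightarrow> (card \<circ> fst) QP' \<le> (card \<circ> fst) QP)"
  proof (rule ex_has_greatest_nat[of valid "({}, \<lambda>_. [])" _ "Suc (card (T0 \<times> T0))"])
    show "valid ({}, \<lambda>_. [])" by (simp add: valid_def disjoint_family_on_def)
    show "\<forall>QP. valid QP \<longrightarrow> (card \<circ> fst) QP < Suc (card (T0 \<times> T0))"
    proof (intro allI impI)
      fix QP assume "valid QP"
      then have "fst QP \<subseteq> T0 \<times> T0" by (auto simp: valid_def)
      then show "(card \<circ> fst) QP < Suc (card (T0 \<times> T0))"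
        unfolding comp_apply less_Suc_eq_le using finT0 by (intro card_mono) auto
    qed
  qed
  then obtain Q P where QP: "valid (Q, P)" and
    max: "\<And>Q' P'. valid (Q', P') \<Longrightarrow> card Q' \<le> card Q" by auto
  have Q: "Q \<subseteq> ?pairs T0" "\<And>x y. (x, y) \<in> Q \<Longrightarrow> awalk x (P (x, y)) y \<and> length (P (x, y)) \<le> 68 / c\<^sup>2"
    "disjoint_family_on (\<lambda>e. set (P e)) Q"
    using QP by (auto simp: valid_def)
  have finQ: "finite Q" by (rule finite_subset[of _ "T0 \<times> T0"]) (use Q(1) finT0 in auto)
  have "card Q \<le> card (T0 \<times> T0)" using Q(1) finT0 by (intro card_mono) auto
  then have cardQ: "card Q \<le> 4 * s\<^sup>2"
    using T0 by (simp add: power2_eq_square card_cartesian_product)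
  define U where "U = (\<Union>e\<in>Q. set (P e))"
  have U: "U \<subseteq> arcs G" using Q(2) by (fastforce simp: U_def awalk_def)
  \<comment> \<open>At most \<open>4 * s\<^sup>2\<close> walks of at most
    \<open>68 / c\<^sup>2\<close> arcs each; one factor \<open>s\<close> is then traded for
    \<open>c ^ 4 * m / 10 ^ 6\<close>.\<close>
  have "real (card U) \<le> (\<Sum>e\<in>Q. real (card (set (P e))))"
    unfolding U_def using card_UN_le[OF finQ, of "\<lambda>e. set (P e)"] by (simp flip: of_nat_sum)
  also have "\<dots> \<le> (\<Sum>e\<in>Q. 68 / c\<^sup>2)"
    using Q(2) card_length by (intro sum_mono) (fastforce intro: order_trans[OF of_nat_mono])
  also have "\<dots> = real (card Q) * (68 / c\<^sup>2)" by simp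
  also have "\<dots> \<le> real (4 * s\<^sup>2) * (68 / c\<^sup>2)" using cardQ by (intro mult_right_mono) (auto simp del: of_nat_mult of_nat_power)
  also have "\<dots> = 272 / c\<^sup>2 * s * s" by (simp add: power2_eq_square)
  also have "\<dots> \<le> 272 / c\<^sup>2 * s * (c ^ 4 * m / 10 ^ 6)" using s by (intro mult_left_mono) auto
  also have "\<dots> = 272 / 10^6 * (s * (c * (c * m)))" using c_pos by (simp add: field_simps power_numeral_reduce)
  also have "\<dots> \<le> 1 / 3200 * (s * (c * (c * m)))" using cm c_pos by (intro mult_right_mono) auto
  finally have N: "3200 * card U \<le> s * c * (c * m)" by simp

  \<comment> \<open>Tails and heads are counted together so that one set \<open>Z\<close> serves
    both \<open>G\<close> and its reversal.\<close>
  define Z where "Z = {v \<in> verts G. c * m / 16 < card {e \<in> U. tail G e = v} + card {e \<in> U. head G e = v}}"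
  have Zsub: "Z \<subseteq> verts G" by (auto simp: Z_def)
  then have finZ: "finite Z" using finite_verts finite_subset by metis
  have "card Z * (c * m) \<le> 32 * real (card U)" unfolding Z_def by (rule card_overloaded[OF U])
  also have "32 * real (card U) \<le> s * c / 100 * (c * m)" using N by simp
  finally have Z: "card Z \<le> s * c / 100" using cm by (simp only: mult_le_cancel_right)

  interpret r: expanding_eulerian "rev_digraph G" F c
    by (rule expanding_eulerian_rev) unfold_locales
  \<comment> \<open>\<open>BO\<close> and \<open>BI\<close> collect the vertices violating the
    hypothesis \<open>good\<close> of \<open>reach_2_ge\<close> in \<open>G\<close> and in its
    reversal.\<close>
  define BO where "BO = {t \<in> verts G. c * m / 8 < card {e \<in> out_arcs G t. head G e \<in> Z}}"
  define BI where "BI = {t \<in> verts G. c * m / 8 < card {e \<in> in_arcs G t. tail G e \<in> Z}}"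
  have fin: "finite BO" "finite BI" by (auto simp: BO_def BI_def)
  have "card BO * c \<le> 8 * real (card Z)" unfolding BO_def by (rule card_many_arcs_into[OF Zsub])
  also have "8 * real (card Z) \<le> s / 10 * c" using Z c_pos by simp
  finally have BO: "card BO \<le> s / 10" using c_pos by (simp only: mult_le_cancel_right)
  have "card BI * c \<le> 8 * real (card Z)" unfolding BI_def using r.card_many_arcs_into[of Z] Zsub by simp
  also have "8 * real (card Z) \<le> s / 10 * c" using Z c_pos by simp
  finally have BI: "card BI \<le> s / 10" using c_pos by (simp only: mult_le_cancel_right)
  have "s * c \<le> real s * 1" using \<open>c \<le> 1\<close> by (intro mult_left_mono) auto
  then have Z': "card Z \<le> s / 10" using Z by simp

  let ?bad = "Z \<union> (BO \<union> BI)"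
  have "card ?bad \<le> card Z + (card BO + card BI)" by (meson add_left_mono card_Un_le order_trans)
  then have "real (card ?bad) \<le> card Z + (card BO + card BI)" by (metis of_nat_add of_nat_mono)
  then have "card ?bad \<le> s" using Z' BO BI by linarith
  moreover have "card T0 - card ?bad \<le> card (T0 - ?bad)" using fin finZ by (intro diff_card_le_card_Diff) auto
  ultimately have "s \<le> card (T0 - ?bad)" using T0 by simp
  then obtain T where T: "T \<subseteq> T0 - ?bad" "card T = s" by (meson obtain_subset_with_card_n)

  \<comment> \<open>A missing pair could be joined by a short walk in the residual arcs,
    contradicting the maximality of \<open>Q\<close>.\<close>
  have "?pairs T \<subseteq> Q"
  proof (rule ccontr)
    assume "\<not> ?pairs T \<subseteq> Q"
    then obtain x y where xy: "x \<in> T" "y \<in> T" "x \<noteq> y" "(x, y) \<notin> Q" by auto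
    then have xyV: "x \<in> verts G - Z" "y \<in> verts G - Z" "x \<in> T0" "y \<in> T0" "x \<notin> BO" "y \<notin> BI" using T T0 by auto
    let ?R = "residual G U Z"
    have load: "card {e \<in> U. tail G e = v} \<le> c * m / 16" "card {e \<in> U. head G e = v} \<le> c * m / 16"
      if "v \<in> verts G - Z" for v
      using that by (auto simp: Z_def not_less)
    have "s * c \<le> m * c" using sm c_pos by (intro mult_right_mono) auto
    then have Z8: "card Z \<le> c * m / 8" using Z cm by (simp add: mult.commute)
    have 1: "c * m / 8 \<le> card (reach G ?R x 2)"
      using load(1) Z8 xyV by (intro reach_2_ge U Zsub) (auto simp: BO_def not_less)
    have 2: "c * m / 8 \<le> card (reach (rev_digraph G) ?R y 2)"
      using load(2) Z8 xyV U Zsub r.reach_2_ge[of U Z y] by (auto simp: BI_def not_less)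
    \<comment> \<open>Every term is at most a small multiple of \<open>c * m * s\<close>, and the
      bound on \<open>s\<close> turns this into order \<open>c ^ 5 * m\<^sup>2\<close>, which is
      below \<open>c\<^sup>2 * m\<^sup>2 / 64\<close>.\<close>
    have "real (card (arcs G - ?R)) \<le> real (card U + 2 * card Z * card (verts G))"
      using card_lost[OF U Zsub] of_nat_mono by blast
    also have "\<dots> = card U + 2 * m * card Z" by simp
    also have "\<dots> \<le> s * c * (c * m) / 3200 + 2 * m * (s * c / 100)"
      using N Z m_ge by (intro add_mono mult_left_mono) auto
    also have "s * c * (c * m) \<le> s * c * (1 * m)" using c_pos \<open>c \<le> 1\<close> by (intro mult_left_mono mult_right_mono) auto
    also have "s * c * (1 * m) / 3200 + 2 * m * (s * c / 100) \<le> c * m * s"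
      using c_pos by simp
    also have "\<dots> \<le> c * m * (c ^ 4 * m / 10 ^ 6)" using s cm by (intro mult_left_mono) auto
    also have "\<dots> = c ^ 5 * (m\<^sup>2 / 10 ^ 6)" by (simp add: power_numeral_reduce)
    also have "\<dots> \<le> c\<^sup>2 * (m\<^sup>2 / 10 ^ 6)" using c4 by (intro mult_right_mono) auto
    also have "\<dots> \<le> c\<^sup>2 * (m\<^sup>2 / 64)" by (intro mult_left_mono) auto
    finally have lost: "card (arcs G - ?R) \<le> c\<^sup>2 * m\<^sup>2 / 64" by simp
    obtain p where p: "awalk x p y" "set p \<subseteq> ?R" "length p \<le> 68 / c\<^sup>2"
      using residual_walk[OF residual_subset _ _ 1 2 lost \<open>c \<le> 1\<close>] xyV by auto
    have pU: "set p \<inter> U = {}" using p by (auto simp: residual_def)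
    have "valid (insert (x, y) Q, P((x, y) := p))"
      using Q xy xyV p pU unfolding valid_def
      by (auto simp: disjoint_family_on_def U_def disjoint_iff)
    then have "card (insert (x, y) Q) \<le> card Q" by (rule max)
    then show False using finQ xy by simp
  qed
  then have "\<forall>x\<in>T. \<forall>y\<in>T. x \<noteq> y \<longrightarrow> awalk x (P (x, y)) y"
      "disjoint_family_on (\<lambda>e. set (P e)) (?pairs T)"
    using Q disjoint_family_on_mono by blast+
  moreover have "T \<subseteq> verts G" using T T0 by auto
  ultimately show ?thesis using T(2) by blast
qed

end

section \<open>Splitting an Eulerian digraph onto a vertex set\<close>

text \<open>With \<open>t\<close> and \<open>h\<close> as parameters this serves both arcs and whole
  walks, the latter through \<open>tail G \<circ> hd\<close> and
  \<open>head G \<circ> last\<close>.\<close>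

definition imbalance :: "('e \<Rightarrow> 'a) \<Rightarrow> ('e \<Rightarrow> 'a) \<Rightarrow> 'e set \<Rightarrow> 'a \<Rightarrow> int" where
  "imbalance t h A v = (\<Sum>e\<in>A. of_bool (t e = v) - of_bool (h e = v))"

lemma imbalance_conv_card:
  "finite A \<Longrightarrow> imbalance t h A v = int (card {e \<in> A. t e = v}) - int (card {e \<in> A. h e = v})"
  by (simp add: imbalance_def sum_subtractf Int_def)

lemma imbalance_Un_disjoint:
  "finite A \<Longrightarrow> finite B \<Longrightarrow> A \<inter> B = {} \<Longrightarrow>
    imbalance t h (A \<union> B) v = imbalance t h A v + imbalance t h B v"
  by (simp add: imbalance_def sum.union_disjoint)

lemma imbalance_image:
  "inj_on f A \<Longrightarrow> imbalance t h (f ` A) v = imbalance (t \<circ> f) (h \<circ> f) A v"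
  by (simp add: imbalance_def sum.reindex)

context fin_digraph
begin

text \<open>
  In a decomposition into as few walks as possible no walk starts where one ends: two such walks
  could be joined, and a closed one could be dropped.
\<close>
lemma walk_decomposition:
  assumes A: "A \<subseteq> arcs G"
  obtains M where "finite M"
    and "\<And>p. p \<in> M \<Longrightarrow> p \<noteq> [] \<and> set p \<subseteq> A \<and> awalk (tail G (hd p)) p (head G (last p))"
    and "\<And>p q. p \<in> M \<Longrightarrow> q \<in> M \<Longrightarrow> p \<noteq> q \<Longrightarrow> set p \<inter> set q = {}"
    and "\<And>p q. p \<in> M \<Longrightarrow> q \<in> M \<Longrightarrow> head G (last p) \<noteq> tail G (hd q)"
    and "\<And>v. imbalance (tail G \<circ> hd) (head G \<circ> last) M v = imbalance (tail G) (head G) A v"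
proof -
  define S where "S = (\<lambda>M. finite M
    \<and> (\<forall>p\<in>M. p \<noteq> [] \<and> set p \<subseteq> A \<and> awalk (tail G (hd p)) p (head G (last p)))
    \<and> (\<forall>p\<in>M. \<forall>q\<in>M. p \<noteq> q \<longrightarrow> set p \<inter> set q = {})
    \<and> (\<forall>v. imbalance (tail G \<circ> hd) (head G \<circ> last) M v = imbalance (tail G) (head G) A v))"
  have finA: "finite A" using A finite_arcs finite_subset by metis
  have "S ((\<lambda>e. [e]) ` A)"
    using A finA by (auto simp: S_def arc_implies_awalk imbalance_image comp_def inj_on_def)
  then have "\<exists>M. S M \<and> (\<forall>M'. S M' \<longrightarrow> card M \<le> card M')" by (rule ex_has_least_nat)
  then obtain M where M: "S M" and min: "\<And>M'. S M' \<Longrightarrow> card M \<le> card M'" by blast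
  have finM: "finite M" and disj: "\<And>p q. p \<in> M \<Longrightarrow> q \<in> M \<Longrightarrow> p \<noteq> q \<Longrightarrow> set p \<inter> set q = {}"
    and walk: "\<And>p. p \<in> M \<Longrightarrow> p \<noteq> [] \<and> set p \<subseteq> A \<and> awalk (tail G (hd p)) p (head G (last p))"
    and imb: "\<And>v. imbalance (tail G \<circ> hd) (head G \<circ> last) M v = imbalance (tail G) (head G) A v"
    using M unfolding S_def by blast+
  have "head G (last p) \<noteq> tail G (hd q)" if pq: "p \<in> M" "q \<in> M" for p q
  proof
    assume eq: "head G (last p) = tail G (hd q)"
    show False
    proof (cases "p = q")
      case True
      \<comment> \<open>The closed walk \<open>p\<close> contributes zero at every vertex.\<close>
      have "imbalance (tail G \<circ> hd) (head G \<circ> last) (M - {p}) v = imbalance (tail G) (head G) A v" for v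
        using imb[of v] eq True unfolding imbalance_def
        by (simp add: sum.remove[OF finM pq(1)])
      then have "S (M - {p})" using finM disj walk unfolding S_def by auto
      then have "card M \<le> card (M - {p})" by (rule min)
      then show False using card_Diff1_less[OF finM pq(1)] by linarith
    next
      case False
      let ?N = "M - {p} - {q}" and ?M' = "insert (p @ q) (M - {p} - {q})"
      have ne: "p \<noteq> []" "q \<noteq> []" using walk pq by auto
      have dN: "set (p @ q) \<inter> set r = {}" if "r \<in> ?N" for r
        using disj[of p r] disj[of q r] that pq by auto
      \<comment> \<open>Otherwise the nonempty \<open>p @ q\<close> would be arc-disjoint from
        itself. So inserting it adds exactly one summand to the imbalance.\<close>
      then have nin: "p @ q \<notin> ?N" using ne by (metis append_is_Nil_conv inf.idem set_empty)
      have q': "q \<in> M - {p}" using pq False by auto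
      have "imbalance (tail G \<circ> hd) (head G \<circ> last) ?M' v = imbalance (tail G) (head G) A v" for v
        using imb[of v] eq ne nin finM q' unfolding imbalance_def
        by (simp add: sum.remove[OF finM pq(1)] sum.remove[OF _ q'])
      moreover have "awalk (tail G (hd (p @ q))) (p @ q) (head G (last (p @ q)))"
        using walk[OF pq(1)] walk[OF pq(2)] eq ne
          awalk_appendI[of "tail G (hd p)" p "tail G (hd q)" q "head G (last q)"] by simp
      moreover have "set (p @ q) \<subseteq> A" using walk pq by auto
      moreover have "\<forall>r\<in>?M'. \<forall>r'\<in>?M'. r \<noteq> r' \<longrightarrow> set r \<inter> set r' = {}"
        using dN disj by (metis Diff_iff Int_commute insertE)
      ultimately have "S ?M'" using finM walk ne unfolding S_def by (simp del: set_append awalk_append_iff)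
      then have "card M \<le> card ?M'" by (rule min)
      also have "\<dots> = Suc (card ?N)" using nin finM by simp
      also have "\<dots> = card (M - {p})" using q' finM by (intro card.remove[symmetric]) auto
      also have "\<dots> < card M" using finM pq by (intro card_Diff1_less)
      finally show False by simp
    qed
  qed
  then show thesis using that finM walk disj imb by blast
qed

end

lemma awalk_concat:
  assumes "wf_digraph G" "verts H \<subseteq> verts G"
    and "\<And>p. p \<in> arcs H \<Longrightarrow> pre_digraph.awalk G (tail H p) p (head H p)"
    and "pre_digraph.awalk H u ps v"
  shows "pre_digraph.awalk G u (concat ps) v"
proof -
  interpret G: wf_digraph G by fact
  have "u \<in> verts G" "set ps \<subseteq> arcs H" "pre_digraph.cas H u ps v"
    using assms by (auto simp: pre_digraph.awalk_def)
  then show ?thesis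
  proof (induction ps arbitrary: u)
    case Nil
    then show ?case by (simp add: pre_digraph.cas.simps G.awalk_Nil_iff)
  next
    case (Cons p ps)
    then have p: "G.awalk u p (head H p)" and "pre_digraph.cas H (head H p) ps v"
      using assms(3) by (auto simp: pre_digraph.cas.simps)
    moreover have "head H p \<in> verts G" using p by auto
    ultimately have "G.awalk (head H p) (concat ps) v" using Cons by auto
    with p show ?case unfolding concat.simps by (rule G.awalk_appendI)
  qed
qed

text \<open>Each arc is the very walk it stands for, so \<open>concat\<close> undoes the contraction
  and arc-disjointness in \<open>G\<close> can be read off the lists.\<close>

definition split_digraph :: "('a, 'b) pre_digraph \<Rightarrow> 'a set \<Rightarrow> 'b list set \<Rightarrow> ('a, 'b list) pre_digraph" where
  "split_digraph G X W = \<lparr>verts = X, arcs = W, tail = tail G \<circ> hd, head = head G \<circ> last\<rparr>"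

lemma split_digraph_simps [simp]:
  "verts (split_digraph G X W) = X" "arcs (split_digraph G X W) = W"
  "tail (split_digraph G X W) p = tail G (hd p)" "head (split_digraph G X W) p = head G (last p)"
  by (simp_all add: split_digraph_def)

text \<open>\<open>W\<close> consists of the arcs of \<open>F\<close> as one-arc walks and a
  decomposition of the other arcs. Imbalances are preserved, so the result is again
  Eulerian.\<close>

lemma (in fin_digraph) expanding_split:
  fixes c :: real
  assumes "eulerian G" and X: "X \<subseteq> verts G" "card X \<ge> 5"
    and F: "F \<subseteq> arcs G" "\<And>e. e \<in> F \<Longrightarrow> tail G e \<in> X \<and> head G e \<in> X"
      "\<And>e. e \<in> F \<Longrightarrow> tail G e \<noteq> head G e" "inj_on (\<lambda>e. {tail G e, head G e}) F"
    and c: "0 < c" "\<And>S. S \<subseteq> X \<Longrightarrow>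
      c * card S * card (X - S) \<le> card {e \<in> F. (tail G e \<in> S) \<noteq> (head G e \<in> S)}"
  obtains W where "expanding_eulerian (split_digraph G X W) ((\<lambda>e. [e]) ` F) c"
    and "\<And>p. p \<in> W \<Longrightarrow> awalk (tail G (hd p)) p (head G (last p))"
    and "\<And>p q. p \<in> W \<Longrightarrow> q \<in> W \<Longrightarrow> p \<noteq> q \<Longrightarrow> set p \<inter> set q = {}"
proof -
  let ?t = "tail G \<circ> hd" and ?h = "head G \<circ> last" and ?F = "(\<lambda>e. [e]) ` F"
  have finF: "finite F" using F finite_arcs finite_subset by metis
  obtain M where finM: "finite M"
    and walk: "\<And>p. p \<in> M \<Longrightarrow> p \<noteq> [] \<and> set p \<subseteq> arcs G - F \<and> awalk (tail G (hd p)) p (head G (last p))"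
    and disj: "\<And>p q. p \<in> M \<Longrightarrow> q \<in> M \<Longrightarrow> p \<noteq> q \<Longrightarrow> set p \<inter> set q = {}"
    and no_through: "\<And>p q. p \<in> M \<Longrightarrow> q \<in> M \<Longrightarrow> head G (last p) \<noteq> tail G (hd q)"
    and imb: "\<And>v. imbalance ?t ?h M v = imbalance (tail G) (head G) (arcs G - F) v"
    using walk_decomposition[of "arcs G - F"] by blast
  have imb0: "imbalance (tail G) (head G) (arcs G) v = 0" for v
  proof (cases "v \<in> verts G")
    case True
    then show ?thesis using \<open>eulerian G\<close>
      by (auto simp: imbalance_conv_card eulerian_def in_degree_def out_degree_def in_arcs_def out_arcs_def)
  next
    case False
    then show ?thesis by (auto simp: imbalance_def intro!: sum.neutral)
  qed
  have "imbalance (tail G) (head G) ((arcs G - F) \<union> F) v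
      = imbalance (tail G) (head G) (arcs G - F) v + imbalance (tail G) (head G) F v" for v
    using finF by (intro imbalance_Un_disjoint) auto
  moreover have "(arcs G - F) \<union> F = arcs G" using F by auto
  ultimately have imbM: "imbalance ?t ?h M v = - imbalance (tail G) (head G) F v" for v
    using imb0[of v] imb[of v] by (simp add: eq_neg_iff_add_eq_0)
  have FM: "?F \<inter> M = {}" using walk by fastforce
  have imbFM: "imbalance ?t ?h (?F \<union> M) v = 0" for v
    using finF finM FM imbM by (simp add: imbalance_Un_disjoint imbalance_image inj_on_def comp_def)
  have outside: "imbalance ?t ?h M v = 0" if "v \<notin> X" for v
    unfolding imbM using that F(2) by (auto simp: imbalance_def intro!: sum.neutral)
  \<comment> \<open>At an end outside \<open>X\<close> the walks of \<open>M\<close> would all start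
    or all end, giving nonzero imbalance, but \<open>F\<close> has no arc there.\<close>
  have ends: "tail G (hd p) \<in> X" "head G (last p) \<in> X" if p: "p \<in> M" for p
  proof -
    show "tail G (hd p) \<in> X"
    proof (rule ccontr)
      let ?v = "tail G (hd p)"
      assume "?v \<notin> X"
      then have "card {q \<in> M. ?t q = ?v} = card {q \<in> M. ?h q = ?v}"
        using outside finM by (simp add: imbalance_conv_card)
      moreover have none: "{q \<in> M. ?h q = ?v} = {}" using no_through p by auto
      ultimately have "card {q \<in> M. ?t q = ?v} = 0" by (simp only: none card.empty)
      then show False using p finM by auto
    qed
    show "head G (last p) \<in> X"
    proof (rule ccontr)
      let ?v = "head G (last p)"
      assume "?v \<notin> X"
      then have "card {q \<in> M. ?t q = ?v} = card {q \<in> M. ?h q = ?v}"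
        using outside finM by (simp add: imbalance_conv_card)
      moreover have none: "{q \<in> M. ?t q = ?v} = {}" using no_through p by fastforce
      ultimately have "card {q \<in> M. ?h q = ?v} = 0" by (simp only: none card.empty)
      then show False using p finM by auto
    qed
  qed
  have exp: "c * card S * card (X - S)
      \<le> card {p \<in> ?F. (tail G (hd p) \<in> S) \<noteq> (head G (last p) \<in> S)}" if "S \<subseteq> X" for S
  proof -
    have "c * card S * card (X - S) \<le> card {e \<in> F. (tail G e \<in> S) \<noteq> (head G e \<in> S)}"
      using c that by simp
    also have "\<dots> = card ((\<lambda>e. [e]) ` {e \<in> F. (tail G e \<in> S) \<noteq> (head G e \<in> S)})"
      by (simp add: card_image inj_on_def)
    also have "(\<lambda>e. [e]) ` {e \<in> F. (tail G e \<in> S) \<noteq> (head G e \<in> S)}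
        = {p \<in> ?F. (tail G (hd p) \<in> S) \<noteq> (head G (last p) \<in> S)}" by auto
    finally show ?thesis .
  qed
  have "expanding_eulerian (split_digraph G X (?F \<union> M)) ?F c"
  proof unfold_locales
    show "finite (verts (split_digraph G X (?F \<union> M)))"
      using finite_subset[OF X(1) finite_verts] by simp
    show "eulerian (split_digraph G X (?F \<union> M))"
      unfolding eulerian_def
    proof
      fix v
      show "in_degree (split_digraph G X (?F \<union> M)) v = out_degree (split_digraph G X (?F \<union> M)) v"
        using imbFM[of v] finF finM
        by (simp add: imbalance_conv_card in_degree_def out_degree_def in_arcs_def out_arcs_def)
    qed
  qed (use F X c finF finM ends no_through exp in \<open>auto simp: inj_on_def\<close>)
  moreover have "awalk (tail G (hd p)) p (head G (last p))" if "p \<in> ?F \<union> M" for p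
    using that walk F(1) by (auto simp: arc_implies_awalk)
  moreover have "set p \<inter> set q = {}" if "p \<in> ?F \<union> M" "q \<in> ?F \<union> M" "p \<noteq> q" for p q
    using that walk disj by fastforce
  ultimately show thesis using that by blast
qed

section \<open>A vertex set with large cuts\<close>

text \<open>\<open>F\<close> is a system of representatives of the arcs under equality of their
  unordered pair of ends, so it keeps an arc between \<open>v\<close> and each neighbour.\<close>

lemma (in multi_digraph) simple_orientation:
  obtains F where "F \<subseteq> arcs G" "inj_on (\<lambda>e. {tail G e, head G e}) F"
    and "\<And>v. v \<in> verts G \<Longrightarrow>
      underlying_degree G v \<le> card {e \<in> F. tail G e = v} + card {e \<in> F. head G e = v}"
proof -
  let ?f = "\<lambda>e. {tail G e, head G e}"
  obtain F where F: "F \<subseteq> arcs G" "inj_on ?f F" "?f ` arcs G = ?f ` F"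
    using subset_image_inj[of "?f ` arcs G" ?f "arcs G"] by auto
  have finF: "finite F" using F finite_arcs finite_subset by metis
  have "underlying_degree G v \<le> card {e \<in> F. tail G e = v} + card {e \<in> F. head G e = v}"
    if "v \<in> verts G" for v
  proof -
    have "{u \<in> verts G - {v}. v \<rightarrow>\<^bsub>G\<^esub> u \<or> u \<rightarrow>\<^bsub>G\<^esub> v}
        \<subseteq> head G ` {e \<in> F. tail G e = v} \<union> tail G ` {e \<in> F. head G e = v}"
    proof
      fix u assume "u \<in> {u \<in> verts G - {v}. v \<rightarrow>\<^bsub>G\<^esub> u \<or> u \<rightarrow>\<^bsub>G\<^esub> v}"
      then have "{u, v} \<in> ?f ` arcs G" by (fastforce simp: arcs_ends_conv)
      then obtain e where "e \<in> F" "{u, v} = {tail G e, head G e}" using F(3) by auto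
      then show "u \<in> head G ` {e \<in> F. tail G e = v} \<union> tail G ` {e \<in> F. head G e = v}"
        by (auto simp: doubleton_eq_iff)
    qed
    then have "underlying_degree G v
        \<le> card (head G ` {e \<in> F. tail G e = v} \<union> tail G ` {e \<in> F. head G e = v})"
      unfolding underlying_degree_eq_card_neighbours using finF by (intro card_mono) auto
    also have "\<dots> \<le> card (head G ` {e \<in> F. tail G e = v}) + card (tail G ` {e \<in> F. head G e = v})"
      by (rule card_Un_le)
    also have "\<dots> \<le> card {e \<in> F. tail G e = v} + card {e \<in> F. head G e = v}"
      using finF by (intro add_mono card_image_le) auto
    finally show ?thesis .
  qed
  with F that show thesis by blast
qed

text \<open>This is the superadditivity gap of the power \<open>3/2\<close>. AM-GM bounds
  \<open>sqrt (m * a)\<close> by \<open>(m + a) / 2\<close>, and the resulting sum is exactly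
  \<open>m\<^sup>2 - a * b\<close>.\<close>

lemma sqrt_split_le:
  fixes a b m :: real
  assumes "0 \<le> a" "0 \<le> b" "a + b = m"
  shows "a * b \<le> m\<^sup>2 - sqrt m * (a * sqrt a + b * sqrt b)"
proof -
  have "0 \<le> m" using assms by simp
  have "sqrt m * (a * sqrt a + b * sqrt b) = a * sqrt (m * a) + b * sqrt (m * b)"
    by (simp add: real_sqrt_mult algebra_simps)
  also have "\<dots> \<le> a * ((m + a) / 2) + b * ((m + b) / 2)"
    using assms(1,2) \<open>0 \<le> m\<close> by (intro add_mono mult_left_mono arith_geo_mean_sqrt)
  also have "\<dots> = m\<^sup>2 - a * b"
    unfolding assms(3)[symmetric] by (simp add: field_simps power2_eq_square)
  finally show ?thesis by simp
qed

lemma (in multi_digraph) expanding_part: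
  fixes \<alpha> :: real
  assumes "\<alpha> > 0" "verts G \<noteq> {}"
    and deg: "\<forall>v \<in> verts G. real (underlying_degree G v) \<ge> \<alpha> * card (verts G)"
  obtains X F and c :: real where "X \<subseteq> verts G" "F \<subseteq> arcs G"
    and "\<And>e. e \<in> F \<Longrightarrow> tail G e \<in> X \<and> head G e \<in> X"
    and "inj_on (\<lambda>e. {tail G e, head G e}) F"
    and "0 < c" "c \<le> 1" "\<alpha> ^ 4 * card (verts G) / 16 \<le> c ^ 4 * card X"
    and "\<And>S. S \<subseteq> X \<Longrightarrow> c * card S * card (X - S) \<le> card {e \<in> F. (tail G e \<in> S) \<noteq> (head G e \<in> S)}"
proof -
  let ?n = "real (card (verts G))"
  have n: "?n > 0" using assms by (simp add: card_gt_0_iff)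
  obtain F0 where F0: "F0 \<subseteq> arcs G" "inj_on (\<lambda>e. {tail G e, head G e}) F0"
    and deg0: "\<And>v. v \<in> verts G \<Longrightarrow>
      underlying_degree G v \<le> card {e \<in> F0. tail G e = v} + card {e \<in> F0. head G e = v}"
    using simple_orientation by blast
  have finF0: "finite F0" using F0 finite_arcs finite_subset by metis
  have tails: "tail G ` F0 \<subseteq> verts G" and heads: "head G ` F0 \<subseteq> verts G" using F0(1) by auto
  \<comment> \<open>Handshake count: each kept arc is seen from both of its ends.\<close>
  have "?n * (\<alpha> * ?n) = (\<Sum>v\<in>verts G. \<alpha> * ?n)" by simp
  also have "\<dots> \<le> (\<Sum>v\<in>verts G. real (card {e \<in> F0. tail G e = v} + card {e \<in> F0. head G e = v}))"
    using deg deg0 by (intro sum_mono) (meson of_nat_mono order_trans)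
  also have "\<dots> = real (card F0 + card F0)"
    using sum_card_fibres[OF finF0 finite_verts tails] sum_card_fibres[OF finF0 finite_verts heads]
    by (simp add: sum.distrib flip: of_nat_sum)
  finally have F0_ge: "\<alpha> * ?n\<^sup>2 / 2 \<le> card F0" by (simp add: power2_eq_square algebra_simps)

  define F where "F = (\<lambda>Y. {e \<in> F0. tail G e \<in> Y \<and> head G e \<in> Y})"
  define d where "d = (\<lambda>Y. card (F Y) / (card Y * sqrt (card Y)))"
  have "F (verts G) = F0" using F0 by (auto simp: F_def)
  have finF: "finite (F Y)" for Y using finF0 by (auto simp: F_def)
  obtain X where X: "X \<subseteq> verts G" "X \<noteq> {}" and max: "\<And>Y. Y \<subseteq> verts G \<Longrightarrow> Y \<noteq> {} \<Longrightarrow> d Y \<le> d X"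
  proof -
    let ?P = "{Y. Y \<subseteq> verts G \<and> Y \<noteq> {}}"
    have "finite ?P" "?P \<noteq> {}" using assms(2) by auto
    then have "Max (d ` ?P) \<in> d ` ?P" by (intro Max_in) auto
    then obtain X where X: "X \<in> ?P" "Max (d ` ?P) = d X" by (rule imageE)
    have "d Y \<le> d X" if "Y \<subseteq> verts G" "Y \<noteq> {}" for Y
      unfolding X(2)[symmetric] using that \<open>finite ?P\<close> by (intro Max_ge) auto
    then show thesis using that X(1) by blast
  qed
  have finX: "finite X" by (rule finite_subset[OF X(1) finite_verts])
  define m where "m = real (card X)"
  have m: "0 < m" "m \<le> ?n" using X finX
    by (auto simp: m_def card_gt_0_iff card_mono)
  define c where "c = card (F X) / m\<^sup>2"
  have FX: "card (F X) = c * m\<^sup>2" using m by (simp add: c_def)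
  have dX: "d X = c * sqrt m"
  proof -
    have "c * m\<^sup>2 / (m * sqrt m) = c * (m / sqrt m)" using m by (simp add: power2_eq_square field_simps)
    also have "m / sqrt m = sqrt m" using m by (simp add: real_div_sqrt)
    finally show ?thesis using FX by (simp add: d_def m_def)
  qed
  have "\<alpha> * sqrt ?n / 2 = (\<alpha> * ?n\<^sup>2 / 2) / (?n * sqrt ?n)"
    using n by (simp add: field_simps power2_eq_square)
  also have "\<dots> \<le> d (verts G)" unfolding d_def \<open>F (verts G) = F0\<close>
    using F0_ge n by (intro divide_right_mono) auto
  also have "\<dots> \<le> d X" using max assms by simp
  finally have dX_ge: "\<alpha> * sqrt ?n / 2 \<le> c * sqrt m" using dX by simp
  moreover have "0 < \<alpha> * sqrt ?n / 2" using assms n by simp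
  ultimately have "0 < c * sqrt m" by linarith
  then have c0: "0 < c" using m by (simp add: zero_less_mult_iff)
  \<comment> \<open>Comparing \<open>X\<close> with \<open>verts G\<close> gives the base
    inequality. Its fourth power bounds \<open>c ^ 4 * m\<^sup>2\<close>, and one factor is removed
    using \<open>m \<le> ?n\<close>.\<close>
  have "(\<alpha> * sqrt ?n / 2) ^ 4 \<le> (c * sqrt m) ^ 4"
    using dX_ge assms by (intro power_mono) auto
  moreover have "sqrt x ^ 4 = x\<^sup>2" if "0 \<le> x" for x :: real
  proof -
    have "sqrt x ^ 4 = ((sqrt x)\<^sup>2)\<^sup>2" by (simp flip: power_mult)
    then show ?thesis using that by simp
  qed
  ultimately have "\<alpha> ^ 4 * ?n\<^sup>2 / 16 \<le> c ^ 4 * m\<^sup>2"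
    using n m by (simp add: power_mult_distrib power_divide)
  then have "\<alpha> ^ 4 * ?n / 16 * ?n \<le> c ^ 4 * m * m" by (simp add: power2_eq_square mult.assoc)
  also have "\<dots> \<le> c ^ 4 * m * ?n" using m c0 by (intro mult_left_mono) auto
  finally have c4: "\<alpha> ^ 4 * ?n / 16 \<le> c ^ 4 * m" using n by (simp only: mult_le_cancel_right)
  have "card (F X) \<le> card (X \<times> X)"
  proof (rule card_inj_on_le)
    show "inj_on (\<lambda>e. (tail G e, head G e)) (F X)"
      using F0(2) by (auto simp: inj_on_def F_def)
    show "finite (X \<times> X)" using finX by simp
  qed (auto simp: F_def)
  then have "real (card (F X)) \<le> m\<^sup>2"
    by (simp add: m_def card_cartesian_product power2_eq_square flip: of_nat_mult)
  then have c1: "c \<le> 1" using m by (simp add: c_def)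
  have F_le: "card (F Y) \<le> c * sqrt m * (card Y * sqrt (card Y))" if "Y \<subseteq> X" for Y
  proof (cases "Y = {}")
    case True
    then show ?thesis by (simp add: F_def)
  next
    case False
    then have "card Y > 0" using finX that by (auto simp: card_gt_0_iff intro: finite_subset)
    moreover have "d Y \<le> c * sqrt m" using max[of Y] that X False dX by auto
    ultimately show ?thesis unfolding d_def by (simp add: pos_divide_le_eq)
  qed
  have "c * card S * card (X - S) \<le> card {e \<in> F X. (tail G e \<in> S) \<noteq> (head G e \<in> S)}"
    if S: "S \<subseteq> X" for S
  proof -
    let ?a = "real (card S)" and ?b = "real (card (X - S))"
    define C where "C = {e \<in> F X. (tail G e \<in> S) \<noteq> (head G e \<in> S)}"
    have finS: "finite S" by (rule finite_subset[OF S finX])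
    have ab: "?a + ?b = m" using finS finX S by (simp add: m_def card_Diff_subset card_mono flip: of_nat_add)
    have "F X = F S \<union> F (X - S) \<union> C" using S by (auto simp: F_def C_def)
    then have "card (F X) \<le> card (F S \<union> F (X - S)) + card C" by (simp only: card_Un_le)
    also have "\<dots> \<le> card (F S) + card (F (X - S)) + card C" by (intro add_right_mono card_Un_le)
    \<comment> \<open>\<open>F X\<close> has \<open>c * m\<^sup>2\<close> arcs; those not crossing
      are bounded by maximality of \<open>X\<close> applied to \<open>S\<close> and
      \<open>X - S\<close>.\<close>
    finally have "c * m\<^sup>2 \<le> card (F S) + card (F (X - S)) + card C" using FX by linarith
    then have "c * m\<^sup>2 \<le> c * sqrt m * (?a * sqrt ?a) + c * sqrt m * (?b * sqrt ?b) + card C"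
      using F_le[OF S] F_le[of "X - S"] by simp
    moreover have "c * (?a * ?b) \<le> c * (m\<^sup>2 - sqrt m * (?a * sqrt ?a + ?b * sqrt ?b))"
      using sqrt_split_le[OF _ _ ab] c0 by (intro mult_left_mono) auto
    ultimately show ?thesis unfolding C_def[symmetric] by (simp add: algebra_simps)
  qed
  moreover have "inj_on (\<lambda>e. {tail G e, head G e}) (F X)"
    by (rule inj_on_subset[OF F0(2)]) (auto simp: F_def)
  moreover have "F X \<subseteq> arcs G" "\<And>e. e \<in> F X \<Longrightarrow> tail G e \<in> X \<and> head G e \<in> X"
    using F0 by (auto simp: F_def)
  ultimately show thesis using that X c0 c1 c4 unfolding m_def by blast
qed

section \<open>Immersion of the complete digraph\<close>

text \<open>Walks suffice, since shortening one to a path uses only its own arcs. Distinct arcs of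
  \<open>K\<close> have distinct pairs of ends, so the family indexed by pairs can be pulled
  back.\<close>

lemma immerses_complete_digraphI:
  assumes "wf_digraph G" and K: "complete_digraph s K"
    and T: "T \<subseteq> verts G" "card T = s"
    and P: "\<And>x y. x \<in> T \<Longrightarrow> y \<in> T \<Longrightarrow> x \<noteq> y \<Longrightarrow> pre_digraph.awalk G x (P (x, y)) y"
    and disj: "disjoint_family_on (\<lambda>e. set (P e)) {(x, y) \<in> T \<times> T. x \<noteq> y}"
  shows "immerses G K"
proof -
  interpret G: wf_digraph G by fact
  interpret K: graph K using K by (simp add: complete_digraph_def)
  have cardK: "card (verts K) = s" using K by (simp add: complete_digraph_def)
  show ?thesis
  proof (cases "s = 0")
    case True
    then have "verts K = {}" using cardK by simp
    then have "arcs K = {}" using K.tail_in_verts by blast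
    with \<open>verts K = {}\<close> show ?thesis by (simp add: immerses_def disjoint_family_on_def)
  next
    case False
    \<comment> \<open>Infinite sets have \<open>card\<close> 0, so only a nonzero \<open>s\<close>
      yields finiteness.\<close>
    then have "finite T" using T card_ge_0_finite by blast
    then obtain f where f: "bij_betw f (verts K) T"
      using finite_same_card_bij[of "verts K" T] cardK T by auto
    let ?g = "\<lambda>e. (f (tail K e), f (head K e))"
    have inj: "inj_on f (verts K)" using f by (rule bij_betw_imp_inj_on)
    have g: "?g e \<in> {(x, y) \<in> T \<times> T. x \<noteq> y}" if "e \<in> arcs K" for e
      using that f K.no_loops[OF that] inj by (auto simp: bij_betw_apply inj_on_eq_iff)
    have injg: "inj_on ?g (arcs K)"
      using K.no_multi_arcs inj by (auto simp: inj_on_def arc_to_ends_def)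
    let ?P = "\<lambda>e. G.awalk_to_apath (P (?g e))"
    have walk: "G.awalk (f (tail K e)) (P (?g e)) (f (head K e))" if "e \<in> arcs K" for e
      using g[OF that] by (intro P) auto
    have "G.apath (f (tail K e)) (?P e) (f (head K e))" if "e \<in> arcs K" for e
      using walk[OF that] by (rule G.apath_awalk_to_apath)
    moreover have "disjoint_family_on (\<lambda>e. set (?P e)) (arcs K)"
      unfolding disjoint_family_on_def
    proof (intro ballI impI)
      fix e e' assume e: "e \<in> arcs K" "e' \<in> arcs K" "e \<noteq> e'"
      then have "?g e \<noteq> ?g e'" using injg by (meson inj_onD)
      then have "set (P (?g e)) \<inter> set (P (?g e')) = {}"
        using disj g[OF e(1)] g[OF e(2)] unfolding disjoint_family_on_def by blast
      then show "set (?P e) \<inter> set (?P e') = {}"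
        using G.awalk_to_apath_subset[OF walk[OF e(1)]] G.awalk_to_apath_subset[OF walk[OF e(2)]] by blast
    qed
    moreover have "f ` verts K \<subseteq> verts G" using f T by (auto simp: bij_betw_def)
    ultimately show ?thesis unfolding immerses_def using inj
      by (intro exI[of _ f] exI[of _ ?P]) auto
  qed
qed

theorem theorem5p1:
  fixes \<alpha> :: real and n s :: nat
    and D :: "('a, 'b) pre_digraph" and K :: "('c, 'd) pre_digraph"
  assumes "\<alpha> > 0"
    and "multi_digraph D" and "eulerian D" and "card (verts D) = n"
    and "\<forall>v \<in> verts D. real (underlying_degree D v) \<ge> \<alpha> * real n"
    and "s = nat \<lfloor>\<alpha> ^ 4 * real n / 10 ^ 9\<rfloor>"
    and "complete_digraph s K"
  shows "immerses D K"
proof (cases "s = 0")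
  case True
  interpret multi_digraph D by fact
  show ?thesis
    by (rule immerses_complete_digraphI[OF wf_digraph assms(7), of "{}"])
      (auto simp: True disjoint_family_on_def)
next
  case False
  interpret multi_digraph D by fact
  have s: "real s \<le> \<alpha> ^ 4 * n / 10 ^ 9" unfolding assms(6) using assms(1) by (intro of_nat_floor) simp
  then have "n \<noteq> 0" using False by (cases n) auto
  then have ne: "verts D \<noteq> {}" using assms(4) by auto
  have deg: "\<forall>v \<in> verts D. real (underlying_degree D v) \<ge> \<alpha> * card (verts D)"
    using assms(4,5) by simp
  obtain X F and c :: real where X: "X \<subseteq> verts D" and F: "F \<subseteq> arcs D"
      "\<And>e. e \<in> F \<Longrightarrow> tail D e \<in> X \<and> head D e \<in> X" "inj_on (\<lambda>e. {tail D e, head D e}) F"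
    and c: "0 < c" "c \<le> 1" "\<alpha> ^ 4 * n / 16 \<le> c ^ 4 * card X"
    and expn: "\<And>S. S \<subseteq> X \<Longrightarrow> c * card S * card (X - S) \<le> card {e \<in> F. (tail D e \<in> S) \<noteq> (head D e \<in> S)}"
    by (rule expanding_part[OF assms(1) ne deg, unfolded assms(4)]) (rule that)
  \<comment> \<open>\<open>16 / 10 ^ 9\<close> is at most \<open>1 / 10 ^ 6\<close>.\<close>
  have sX: "real s \<le> c ^ 4 * card X / 10 ^ 6" using s c(3) by simp
  have "c ^ 4 * card X \<le> 1 * real (card X)" using c by (intro mult_right_mono) (auto simp: power_le_one)
  \<comment> \<open>As \<open>s\<close> is at least 1, \<open>X\<close> has at least
    \<open>10 ^ 6\<close> elements.\<close>
  then have cardX: "card X \<ge> 5" using sX False by simp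
  have noloop: "\<And>e. e \<in> F \<Longrightarrow> tail D e \<noteq> head D e" using F(1) no_loops by blast
  obtain W where W: "expanding_eulerian (split_digraph D X W) ((\<lambda>e. [e]) ` F) c"
    and walk: "\<And>p. p \<in> W \<Longrightarrow> awalk (tail D (hd p)) p (head D (last p))"
    and disj: "\<And>p q. p \<in> W \<Longrightarrow> q \<in> W \<Longrightarrow> p \<noteq> q \<Longrightarrow> set p \<inter> set q = {}"
    by (rule expanding_split[OF assms(3) X cardX F(1,2) noloop F(3) c(1) expn]; (rule that)?)
  let ?H = "split_digraph D X W"
  interpret H: expanding_eulerian ?H "(\<lambda>e. [e]) ` F" c by fact
  have sH: "real s \<le> c ^ 4 * card (verts ?H) / 10 ^ 6" using sX by simp
  obtain T P where T: "T \<subseteq> verts ?H" "card T = s"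
    and P: "\<forall>x\<in>T. \<forall>y\<in>T. x \<noteq> y \<longrightarrow> H.awalk x (P (x, y)) y"
    and disjP: "disjoint_family_on (\<lambda>e. set (P e)) {(x, y) \<in> T \<times> T. x \<noteq> y}"
    using H.complete_packing[OF c(2) sH] by (elim exE conjE)
  show ?thesis
  proof (rule immerses_complete_digraphI[OF wf_digraph assms(7)])
    show "T \<subseteq> verts D" "card T = s" using T X by auto
    show "awalk x (concat (P (x, y))) y" if "x \<in> T" "y \<in> T" "x \<noteq> y" for x y
      using P that X walk by (intro awalk_concat[OF wf_digraph, of ?H]) simp_all
    show "disjoint_family_on (\<lambda>e. set (concat (P e))) {(x, y) \<in> T \<times> T. x \<noteq> y}"
      unfolding disjoint_family_on_def
    proof (intro ballI impI)
      fix e e' assume e: "e \<in> {(x, y) \<in> T \<times> T. x \<noteq> y}" "e' \<in> {(x, y) \<in> T \<times> T. x \<noteq> y}" "e \<noteq> e'"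
      \<comment> \<open>The two walks use disjoint subsets of \<open>W\<close>, and distinct members
        of \<open>W\<close> share no arc of \<open>D\<close>.\<close>
      have "set (P e) \<subseteq> W" "set (P e') \<subseteq> W" using e P by (auto simp: H.awalk_def)
      moreover have "set (P e) \<inter> set (P e') = {}" using disjP e unfolding disjoint_family_on_def by blast
      ultimately show "set (concat (P e)) \<inter> set (concat (P e')) = {}"
        using disj by (fastforce simp: disjoint_iff)
    qed
  qed
qed

end
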